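(* Let $k,N\ge 1$ be integers, $n=N^2$, and $\alpha\in\mathbb{R}$. For a one-channel convolution kernel $K\in\mathbb{R}^{k\times k}$ let $M=M(K)=(m_{ij})\in\mathbb{R}^{n\times n}$ be the doubly block banded Toeplitz transformation matrix corresponding to $K$ (acting on $N\times N$ inputs). Fix $p,q\in\{1,\dots,k\}$ and let $\Omega$ be the set of all index pairs $(i,j)\in\{1,\dots,n\}^2$ such that $m_{ij}=K_{p,q}$, i.e. the positions of $M$ occupied by the parameter $K_{p,q}$ (equality of $m_{ij}$ and $K_{p,q}$ as functions of $K$). Then, regarding $\|M^TM-\alpha I\|_F^2$ as a function of the entries of $K$, $$\frac12\,\frac{\partial \|M^TM-\alpha I\|_F^2}{\partial K_{p,q}}=\sum_{(i,j)\in\Omega}\left(\sum_{t=1}^{n}(M^TM-\alpha I)_{j,t}\,m_{it}+\sum_{s=1}^{n}(M^TM-\alpha I)_{s,j}\,m_{is}\right).$$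
   Context: $\|\cdot\|_F$ is the Frobenius norm, $I$ is the $n\times n$ identity matrix, and $(B)_{s,t}$ denotes the $(s,t)$ entry of a matrix $B$. Convolution (deep-learning convention, no flip, unit stride, zero padding, output of the same size): for $K\in\mathbb{R}^{k\times k}$ and $X\in\mathbb{R}^{N\times N}$, the output $Y=K*X\in\mathbb{R}^{N\times N}$ is $$Y_{r,s}=\sum_{p=1}^{k}\sum_{q=1}^{k}X_{r-m+p,\,s-m+q}\,K_{p,q},\qquad m=\lceil k/2\rceil,$$ where $X_{i,j}=0$ if $i\le 0$ or $i>N$ or $j\le 0$ or $j>N$. $\mathrm{vec}(X)$ is the column vector obtained by stacking the columns of $X$ on top of one another. The transformation matrix corresponding to $K$ is the unique $M\in\mathbb{R}^{N^2\times N^2}$ with $\mathrm{vec}(K*X)=M\,\mathrm{vec}(X)$ for all $X\in\mathbb{R}^{N\times N}$. It is a block banded Toeplitz matrix whose blocks are banded Toeplitz matrices. Every position of $M$ is either identically zero or is occupied by exactly one parameter $K_{p,q}$: for $r,s,r',s'\in\{1,\dots,N\}$, the entry of $M$ in row $(s-1)N+r$ and column $(s'-1)N+r'$ equals $K_{p,q}$ with $p=r'-r+m$, $q=s'-s+m$ if $1\le p,q\le k$, and equals $0$ otherwise. *)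

theory Defs
  imports "HOL-Analysis.Derivative" "Jordan_Normal_Form.Matrix"
begin

text \<open>
  Matrix and vector indices start at 0, as in \<^theory>\<open>Jordan_Normal_Form.Matrix\<close>: the entry written
  $(B)_{s,t}$ in 1-based notation is \<open>B $$ (s - 1, t - 1)\<close>, and $K_{p,q}$ with $1 \le p, q \le k$
  is \<open>K $$ (p - 1, q - 1)\<close>.
\<close>

definition frobenius_norm :: "real mat \<Rightarrow> real" where
  "frobenius_norm A = sqrt (\<Sum>i<dim_row A. \<Sum>j<dim_col A. (A $$ (i, j))\<^sup>2)"

definition zero_pad :: "real mat \<Rightarrow> int \<Rightarrow> int \<Rightarrow> real" where
  "zero_pad X i j =
     (if 0 \<le> i \<and> i < int (dim_row X) \<and> 0 \<le> j \<and> j < int (dim_col X)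
      then X $$ (nat i, nat j) else 0)"

text \<open>
  The 1-based formula is
  $Y_{r,s} = \sum_{p,q=1}^{k} X_{r-m+p,\,s-m+q}\, K_{p,q}$ with $m = \lceil k/2 \rceil$.
  Replacing each of $r$, $p$ and the row index of $X$ by its 0-based counterpart turns the row index
  $r - m + p$ into $(r + 1) - m + (p + 1) - 1 = r - m + p + 1$; likewise for columns.
\<close>
definition conv :: "real mat \<Rightarrow> real mat \<Rightarrow> real mat" where
  "conv K X =
     (let k = dim_row K; m = \<lceil>real k / 2\<rceil> in
      mat (dim_row X) (dim_col X) (\<lambda>(r, s).
        \<Sum>p<k. \<Sum>q<k. zero_pad X (int r - m + int p + 1) (int s - m + int q + 1) * K $$ (p, q)))"

text \<open>Column stacking: \<open>X $$ (r, s)\<close> is placed at position \<open>s * dim_row X + r\<close>.\<close>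
definition vec_of_mat :: "real mat \<Rightarrow> real Matrix.vec" where
  "vec_of_mat X =
     Matrix.vec (dim_row X * dim_col X) (\<lambda>i. X $$ (i mod dim_row X, i div dim_row X))"

definition is_transf_mat :: "nat \<Rightarrow> real mat \<Rightarrow> real mat \<Rightarrow> bool" where
  "is_transf_mat N K M \<longleftrightarrow>
     M \<in> carrier_mat (N\<^sup>2) (N\<^sup>2) \<and>
     (\<forall>X \<in> carrier_mat N N. vec_of_mat (conv K X) = M *\<^sub>v vec_of_mat X)"

definition transf_mat :: "nat \<Rightarrow> real mat \<Rightarrow> real mat" where
  "transf_mat N K = (THE M. is_transf_mat N K M)"

text \<open>
  The positions of the transformation matrix occupied by the parameter \<open>K $$ (p, q)\<close>. Equality of
  the two entries is meant as functions of the kernel, hence the quantification over all kernels.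
\<close>
definition occupied :: "nat \<Rightarrow> nat \<Rightarrow> nat \<Rightarrow> nat \<Rightarrow> (nat \<times> nat) set" where
  "occupied k N p q =
     {(i, j). i < N\<^sup>2 \<and> j < N\<^sup>2 \<and>
              (\<forall>K \<in> carrier_mat k k. transf_mat N K $$ (i, j) = K $$ (p, q))}"

text \<open>The one-variable function obtained from \<open>f\<close> by freezing all entries of \<open>K\<close> but \<open>(p, q)\<close>.\<close>
definition entry_slice :: "(real mat \<Rightarrow> real) \<Rightarrow> real mat \<Rightarrow> nat \<Rightarrow> nat \<Rightarrow> real \<Rightarrow> real" where
  "entry_slice f K p q = (\<lambda>x. f (K |\<^sub>m (p, q) \<mapsto> x))"

definition partially_differentiable :: "(real mat \<Rightarrow> real) \<Rightarrow> real mat \<Rightarrow> nat \<Rightarrow> nat \<Rightarrow> bool" where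
  "partially_differentiable f K p q \<longleftrightarrow>
     entry_slice f K p q field_differentiable at (K $$ (p, q))"

definition partial_deriv :: "(real mat \<Rightarrow> real) \<Rightarrow> real mat \<Rightarrow> nat \<Rightarrow> nat \<Rightarrow> real" where
  "partial_deriv f K p q = deriv (entry_slice f K p q) (K $$ (p, q))"

end

theory Submission
  imports Defs
begin

text \<open>
  Raising \<open>K $$ (p, q)\<close> by \<open>h\<close> raises \<open>M\<close> by \<open>h\<close> exactly at the occupied positions, so the entries of
  \<open>M\<close> have partial derivative 1 there and 0 elsewhere. The formula is the chain rule for
  $\sum_{s,t} (\sum_l m_{ls} m_{lt} - \alpha \delta_{st})^2$ with the summations interchanged.
\<close>

lemma update_mat_carrier [simp]:
  "A |\<^sub>m ij \<mapsto> a \<in> carrier_mat m n \<longleftrightarrow> A \<in> carrier_mat m n"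
  unfolding carrier_mat_def by simp

lemma index_update_mat_if:
  assumes "i < dim_row A" "j < dim_col A"
  shows "(A |\<^sub>m ij \<mapsto> a) $$ (i, j) = (if (i, j) = ij then a else A $$ (i, j))"
  using assms by (simp add: update_mat_def)

text \<open>
  With 0-based indices, \<open>i\<close> and \<open>j\<close> stand for the pixels \<open>(i mod N, i div N)\<close> and
  \<open>(j mod N, j div N)\<close>; the final \<open>- 1\<close> comes from the 0-based kernel indices. \<^const>\<open>zero_pad\<close> applied to
  the kernel makes the entries outside the bands vanish.
\<close>
definition kernel_toeplitz :: "nat \<Rightarrow> real mat \<Rightarrow> real mat" where
  "kernel_toeplitz N K =
     (let m = \<lceil>real (dim_row K) / 2\<rceil> in
      mat (N\<^sup>2) (N\<^sup>2) (\<lambda>(i, j).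
        zero_pad K (int (j mod N) - int (i mod N) + m - 1)
                   (int (j div N) - int (i div N) + m - 1)))"

lemma kernel_toeplitz_carrier [simp]: "kernel_toeplitz N K \<in> carrier_mat (N\<^sup>2) (N\<^sup>2)"
  by (simp add: kernel_toeplitz_def Let_def)

section \<open>Column stacking and zero padding as finite sums\<close>

text \<open>Column stacking is the bijection behind this: \<open>j\<close> encodes the pixel in row
  \<open>j mod N\<close> and column \<open>j div N\<close>. It turns a matrix-vector product into a
  sum over pixels.\<close>

lemma sum_square_div_mod:
  fixes f :: "nat \<Rightarrow> nat \<Rightarrow> 'a::comm_monoid_add"
  shows "(\<Sum>j<N\<^sup>2. f (j mod N) (j div N)) = (\<Sum>(u, v)\<in>{..<N} \<times> {..<N}. f u v)"
proof (rule sum.reindex_bij_witness[where j = "\<lambda>j. (j mod N, j div N)" and i = "\<lambda>(u, v). v * N + u"])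
  fix b assume "b \<in> {..<N} \<times> {..<N}"
  then obtain u v where b: "b = (u, v)" "u < N" "v < N" by auto
  have "v * N + u < (v + 1) * N" using b by simp
  also have "\<dots> \<le> N * N" using b by (intro mult_right_mono) auto
  finally show "(case b of (u, v) \<Rightarrow> v * N + u) \<in> {..<N\<^sup>2}"
    using b by (simp add: power2_eq_square)
qed (auto simp: power2_eq_square less_mult_imp_div_less intro!: mod_less_divisor gr0I)

text \<open>At most one summand survives, and none when the position lies in the padding. In this
  form the boundary cases disappear and sums over kernel and image can be interchanged.\<close>

lemma zero_pad_eq_sum:
  "zero_pad X i j = (\<Sum>(u, v)\<in>{..<dim_row X} \<times> {..<dim_col X}.
     if int u = i \<and> int v = j then X $$ (u, v) else 0)"
proof (cases "0 \<le> i \<and> i < int (dim_row X) \<and> 0 \<le> j \<and> j < int (dim_col X)")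
  case True
  then have iff: "int u = i \<and> int v = j \<longleftrightarrow> (u, v) = (nat i, nat j)" for u v
    by auto
  have "(\<Sum>(u, v)\<in>{..<dim_row X} \<times> {..<dim_col X}.
      if int u = i \<and> int v = j then X $$ (u, v) else 0) =
    (\<Sum>x\<in>{..<dim_row X} \<times> {..<dim_col X}. if x = (nat i, nat j) then X $$ x else 0)"
    unfolding iff by (intro sum.cong refl) (simp only: case_prod_beta prod.collapse)
  also have "\<dots> = X $$ (nat i, nat j)"
    using True by (subst sum.delta) auto
  finally show ?thesis
    using True by (simp add: zero_pad_def)
next
  case False
  then have "(\<Sum>(u, v)\<in>{..<dim_row X} \<times> {..<dim_col X}.
      if int u = i \<and> int v = j then X $$ (u, v) else 0) = 0"
    by (intro sum.neutral) auto
  with False show ?thesis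
    by (auto simp: zero_pad_def)
qed

lemma zero_pad_update:
  assumes "p < dim_row X" "q < dim_col X"
  shows "zero_pad (X |\<^sub>m (p, q) \<mapsto> x) i j = (if i = int p \<and> j = int q then x else zero_pad X i j)"
proof (cases "0 \<le> i \<and> i < int (dim_row X) \<and> 0 \<le> j \<and> j < int (dim_col X)")
  case True
  then show ?thesis
    by (auto simp: zero_pad_def index_update_mat_if)
next
  case False
  then show ?thesis
    using assms by (auto simp: zero_pad_def)
qed

text \<open>Both sides sum \<open>K $$ (p, q) * X $$ (u, v)\<close> over all pairs with
  \<open>u = a + p\<close> and \<open>v = b + q\<close>. Solving for \<open>(p, q)\<close> instead
  of \<open>(u, v)\<close> moves the padding from the image to the kernel, which exhibits the
  convolution as linear in \<open>X\<close>.\<close>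

lemma sum_zero_pad_swap:
  assumes "K \<in> carrier_mat k l" "X \<in> carrier_mat M N"
  shows "(\<Sum>(p, q)\<in>{..<k} \<times> {..<l}. zero_pad X (a + int p) (b + int q) * K $$ (p, q)) =
         (\<Sum>(u, v)\<in>{..<M} \<times> {..<N}. zero_pad K (int u - a) (int v - b) * X $$ (u, v))"
proof -
  have "(\<Sum>(p, q)\<in>{..<k} \<times> {..<l}. zero_pad X (a + int p) (b + int q) * K $$ (p, q)) =
      (\<Sum>(p, q)\<in>{..<k} \<times> {..<l}. \<Sum>(u, v)\<in>{..<M} \<times> {..<N}.
        if int u = a + int p \<and> int v = b + int q then X $$ (u, v) * K $$ (p, q) else 0)"
    using assms by (auto simp: zero_pad_eq_sum sum_distrib_right intro!: sum.cong)
  also have "\<dots> = (\<Sum>(u, v)\<in>{..<M} \<times> {..<N}. \<Sum>(p, q)\<in>{..<k} \<times> {..<l}.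
        if int p = int u - a \<and> int q = int v - b then K $$ (p, q) * X $$ (u, v) else 0)"
    unfolding case_prod_beta by (subst sum.swap) (auto intro!: sum.cong)
  also have "\<dots> = (\<Sum>(u, v)\<in>{..<M} \<times> {..<N}. zero_pad K (int u - a) (int v - b) * X $$ (u, v))"
    using assms by (auto simp: zero_pad_eq_sum sum_distrib_right intro!: sum.cong)
  finally show ?thesis .
qed

section \<open>The transformation matrix in closed form\<close>

lemma vec_of_conv:
  assumes K: "K \<in> carrier_mat k k" and X: "X \<in> carrier_mat N N"
  shows "vec_of_mat (conv K X) = kernel_toeplitz N K *\<^sub>v vec_of_mat X"
proof (rule eq_vecI)
  fix i assume "i < dim_vec (kernel_toeplitz N K *\<^sub>v vec_of_mat X)"
  then have i: "i < N\<^sup>2"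
    by (simp add: kernel_toeplitz_def Let_def)
  then have N: "0 < N" by (auto intro: gr0I)
  define r s where "r = i mod N" and "s = i div N"
  define m where "m = \<lceil>real k / 2\<rceil>"
  have rs: "r < N" "s < N"
    using i N by (auto simp: r_def s_def power2_eq_square less_mult_imp_div_less)
  have "vec_index (vec_of_mat (conv K X)) i = conv K X $$ (r, s)"
    using i X by (simp add: vec_of_mat_def conv_def Let_def r_def s_def power2_eq_square)
  \<comment> \<open>The shifts are \<open>a = r - m + 1\<close> and \<open>b = s - m + 1\<close>.
    After the swap the kernel is read at \<open>u - a = u - r + m - 1\<close> and
    \<open>v - b = v - s + m - 1\<close>, the offsets in \<open>kernel_toeplitz\<close>.\<close>
  also have "\<dots> = (\<Sum>(p, q)\<in>{..<k} \<times> {..<k}.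
      zero_pad X ((int r - m + 1) + int p) ((int s - m + 1) + int q) * K $$ (p, q))"
    using rs K X by (simp add: conv_def Let_def m_def sum.cartesian_product algebra_simps)
  also have "\<dots> = (\<Sum>(u, v)\<in>{..<N} \<times> {..<N}.
      zero_pad K (int u - (int r - m + 1)) (int v - (int s - m + 1)) * X $$ (u, v))"
    by (rule sum_zero_pad_swap[OF K X])
  also have "\<dots> = (\<Sum>j<N\<^sup>2. zero_pad K (int (j mod N) - (int r - m + 1))
      (int (j div N) - (int s - m + 1)) * X $$ (j mod N, j div N))"
    by (rule sum_square_div_mod[symmetric])
  also have "\<dots> = vec_index (kernel_toeplitz N K *\<^sub>v vec_of_mat X) i"
    using i K X
    by (simp add: kernel_toeplitz_def vec_of_mat_def scalar_prod_def Let_def r_def s_def m_def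
        power2_eq_square lessThan_atLeast0 algebra_simps)
  finally show "vec_index (vec_of_mat (conv K X)) i =
    vec_index (kernel_toeplitz N K *\<^sub>v vec_of_mat X) i" .
qed (use X in \<open>simp add: vec_of_mat_def conv_def kernel_toeplitz_def Let_def power2_eq_square\<close>)

text \<open>Needed for uniqueness: the transformation matrix is prescribed only on stacked images,
  and these exhaust the whole space.\<close>

lemma vec_of_mat_surj:
  assumes "v \<in> carrier_vec (N\<^sup>2)"
  obtains X where "X \<in> carrier_mat N N" "vec_of_mat X = v"
proof
  show "mat N N (\<lambda>(r, s). vec_index v (s * N + r)) \<in> carrier_mat N N"
    by simp
  have "i mod N < N \<and> i div N < N" if "i < N * N" for i
    using that by (auto simp: less_mult_imp_div_less intro!: mod_less_divisor gr0I)
  then show "vec_of_mat (mat N N (\<lambda>(r, s). vec_index v (s * N + r))) = v"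
    using assms by (intro eq_vecI) (auto simp: vec_of_mat_def power2_eq_square)
qed

lemma mat_eq_if_mult_vec_eq:
  fixes A B :: "'a::semiring_1 mat"
  assumes A: "A \<in> carrier_mat m n" and B: "B \<in> carrier_mat m n"
    and eq: "\<And>v. v \<in> carrier_vec n \<Longrightarrow> A *\<^sub>v v = B *\<^sub>v v"
  shows "A = B"
proof (rule eq_matI)
  fix i j assume ij: "i < dim_row B" "j < dim_col B"
  have "vec_index (A *\<^sub>v unit_vec n j) i = vec_index (B *\<^sub>v unit_vec n j) i"
    by (simp add: eq)
  then show "A $$ (i, j) = B $$ (i, j)"
    using ij A B by simp
qed (use A B in auto)

text \<open>Existence is \<open>vec_of_conv\<close>. Uniqueness holds because two candidates agree
  on every stacked image, hence on every vector, in particular on the unit vectors.\<close>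

lemma transf_mat_eq_kernel_toeplitz:
  assumes K: "K \<in> carrier_mat k k"
  shows "transf_mat N K = kernel_toeplitz N K"
  unfolding transf_mat_def
proof (rule the_equality)
  show T: "is_transf_mat N K (kernel_toeplitz N K)"
    using vec_of_conv[OF K] by (simp add: is_transf_mat_def)
  fix M assume M: "is_transf_mat N K M"
  show "M = kernel_toeplitz N K"
  proof (rule mat_eq_if_mult_vec_eq)
    fix v :: "real Matrix.vec" assume "v \<in> carrier_vec (N\<^sup>2)"
    then obtain X where "X \<in> carrier_mat N N" "vec_of_mat X = v"
      by (rule vec_of_mat_surj)
    then show "M *\<^sub>v v = kernel_toeplitz N K *\<^sub>v v"
      using M T by (auto simp: is_transf_mat_def)
  qed (use M in \<open>auto simp: is_transf_mat_def\<close>)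
qed

section \<open>Occupied positions and dependence on a single parameter\<close>

lemma occupied_iff:
  assumes pq: "p < k" "q < k"
  shows "(i, j) \<in> occupied k N p q \<longleftrightarrow> i < N\<^sup>2 \<and> j < N\<^sup>2 \<and>
    int (j mod N) - int (i mod N) + \<lceil>real k / 2\<rceil> - 1 = int p \<and>
    int (j div N) - int (i div N) + \<lceil>real k / 2\<rceil> - 1 = int q"
    (is "_ \<longleftrightarrow> _ \<and> _ \<and> ?P = _ \<and> ?Q = _")
proof
  assume L: "(i, j) \<in> occupied k N p q"
  \<comment> \<open>The kernel with a single 1 at \<open>(p, q)\<close> is a sufficient test: its
    padded entries vanish everywhere else, so the value 1 at \<open>(i, j)\<close> determines both
    offsets.\<close>
  define E where "E = mat k k (\<lambda>x. if x = (p, q) then 1 else 0 :: real)"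
  have E: "E \<in> carrier_mat k k" by (simp add: E_def)
  have ij: "i < N\<^sup>2" "j < N\<^sup>2" and "transf_mat N E $$ (i, j) = E $$ (p, q)"
    using L E by (auto simp: occupied_def)
  then have "zero_pad E ?P ?Q = 1"
    using pq E by (simp add: transf_mat_eq_kernel_toeplitz[OF E] kernel_toeplitz_def Let_def)
       (simp add: E_def)
  then have "?P = int p \<and> ?Q = int q"
    by (auto simp: zero_pad_def E_def split: if_splits)
  with ij show "i < N\<^sup>2 \<and> j < N\<^sup>2 \<and> ?P = int p \<and> ?Q = int q" by simp
next
  assume "i < N\<^sup>2 \<and> j < N\<^sup>2 \<and> ?P = int p \<and> ?Q = int q"
  then show "(i, j) \<in> occupied k N p q"
    using pq by (auto simp: occupied_def transf_mat_eq_kernel_toeplitz kernel_toeplitz_def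
        Let_def zero_pad_def)
qed

text \<open>A position that is not occupied reads another kernel entry or the padding, and the
  update changes neither.\<close>

lemma transf_mat_update:
  assumes K: "K \<in> carrier_mat k k" and pq: "p < k" "q < k" and ij: "i < N\<^sup>2" "j < N\<^sup>2"
  shows "transf_mat N (K |\<^sub>m (p, q) \<mapsto> x) $$ (i, j) =
    (if (i, j) \<in> occupied k N p q then x else transf_mat N K $$ (i, j))"
  using K pq ij
  by (simp add: transf_mat_eq_kernel_toeplitz[of _ k] occupied_iff kernel_toeplitz_def
      Let_def zero_pad_update)

section \<open>Differentiating the squared norm of a shifted Gram matrix\<close>

lemma frobenius_norm_square:
  "(frobenius_norm A)\<^sup>2 = (\<Sum>i<dim_row A. \<Sum>j<dim_col A. (A $$ (i, j))\<^sup>2)"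
  unfolding frobenius_norm_def by (intro real_sqrt_pow2 sum_nonneg) auto

lemma gram_shift_index:
  assumes A: "A \<in> carrier_mat m n" and st: "s < n" "t < n"
  shows "(transpose_mat A * A - \<alpha> \<cdot>\<^sub>m 1\<^sub>m n) $$ (s, t) =
    (\<Sum>l<m. A $$ (l, s) * A $$ (l, t)) - \<alpha> * (if s = t then 1 else 0)"
  using A st by (simp add: scalar_prod_def lessThan_atLeast0)

text \<open>Chain rule along an arbitrary matrix curve with entrywise derivatives \<open>D\<close>
  at \<open>x0\<close>. The product rule gives two terms for each Gram entry, one per differentiated
  factor; regrouping by the differentiated entry \<open>(i, j)\<close> yields the two inner
  sums.\<close>

lemma frobenius_gram_has_derivative:
  fixes A :: "real \<Rightarrow> real mat"
  assumes A: "\<And>x. A x \<in> carrier_mat m n"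
    and A': "\<And>i j. i < m \<Longrightarrow> j < n \<Longrightarrow> ((\<lambda>x. A x $$ (i, j)) has_field_derivative D i j) (at x0)"
    and G: "G = transpose_mat (A x0) * A x0 - \<alpha> \<cdot>\<^sub>m 1\<^sub>m n"
  shows "((\<lambda>x. (frobenius_norm (transpose_mat (A x) * A x - \<alpha> \<cdot>\<^sub>m 1\<^sub>m n))\<^sup>2)
    has_field_derivative
      2 * (\<Sum>i<m. \<Sum>j<n. D i j *
        ((\<Sum>t<n. G $$ (j, t) * A x0 $$ (i, t)) + (\<Sum>s<n. G $$ (s, j) * A x0 $$ (i, s))))) (at x0)"
proof -
  have F: "(frobenius_norm (transpose_mat (A x) * A x - \<alpha> \<cdot>\<^sub>m 1\<^sub>m n))\<^sup>2 =
      (\<Sum>s<n. \<Sum>t<n. ((\<Sum>l<m. A x $$ (l, s) * A x $$ (l, t)) - \<alpha> * (if s = t then 1 else 0))\<^sup>2)" for x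
    using A[of x] by (simp add: frobenius_norm_square gram_shift_index[OF A] del: index_minus_mat(1))
  have "((\<lambda>x. \<Sum>s<n. \<Sum>t<n. ((\<Sum>l<m. A x $$ (l, s) * A x $$ (l, t)) - \<alpha> * (if s = t then 1 else 0))\<^sup>2)
    has_field_derivative
      (\<Sum>s<n. \<Sum>t<n. 2 * G $$ (s, t) *
        (\<Sum>l<m. D l s * A x0 $$ (l, t) + D l t * A x0 $$ (l, s)))) (at x0)"
    by (auto intro!: derivative_eq_intros A' sum.cong simp: G gram_shift_index[OF A] simp del: index_minus_mat(1))
  moreover have "(\<Sum>s<n. \<Sum>t<n. 2 * G $$ (s, t) *
        (\<Sum>l<m. D l s * A x0 $$ (l, t) + D l t * A x0 $$ (l, s))) =
      2 * (\<Sum>i<m. \<Sum>j<n. D i j *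
        ((\<Sum>t<n. G $$ (j, t) * A x0 $$ (i, t)) + (\<Sum>s<n. G $$ (s, j) * A x0 $$ (i, s))))"
  proof -
    \<comment> \<open>The factor in column \<open>s\<close> is differentiated, so
      \<open>(l, s)\<close> takes the role of \<open>(i, j)\<close> and \<open>t\<close> stays
      innermost.\<close>
    have a: "(\<Sum>s<n. \<Sum>t<n. \<Sum>l<m. G $$ (s, t) * (D l s * A x0 $$ (l, t))) =
        (\<Sum>i<m. \<Sum>j<n. \<Sum>t<n. D i j * (G $$ (j, t) * A x0 $$ (i, t)))" (is "?L = _")
    proof -
      have "?L = (\<Sum>s<n. \<Sum>l<m. \<Sum>t<n. G $$ (s, t) * (D l s * A x0 $$ (l, t)))"
        by (intro sum.cong refl sum.swap)
      also have "\<dots> = (\<Sum>l<m. \<Sum>s<n. \<Sum>t<n. G $$ (s, t) * (D l s * A x0 $$ (l, t)))"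
        by (rule sum.swap)
      finally show ?thesis
        by (simp add: mult_ac)
    qed
    \<comment> \<open>Now the factor in column \<open>t\<close> is differentiated:
      \<open>(l, t)\<close> becomes \<open>(i, j)\<close>, and \<open>s\<close> has to move
      inside.\<close>
    have b: "(\<Sum>s<n. \<Sum>t<n. \<Sum>l<m. G $$ (s, t) * (D l t * A x0 $$ (l, s))) =
        (\<Sum>i<m. \<Sum>j<n. \<Sum>s<n. D i j * (G $$ (s, j) * A x0 $$ (i, s)))" (is "?L = _")
    proof -
      have "?L = (\<Sum>t<n. \<Sum>s<n. \<Sum>l<m. G $$ (s, t) * (D l t * A x0 $$ (l, s)))"
        by (rule sum.swap)
      also have "\<dots> = (\<Sum>t<n. \<Sum>l<m. \<Sum>s<n. G $$ (s, t) * (D l t * A x0 $$ (l, s)))"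
        by (intro sum.cong refl sum.swap)
      also have "\<dots> = (\<Sum>l<m. \<Sum>t<n. \<Sum>s<n. G $$ (s, t) * (D l t * A x0 $$ (l, s)))"
        by (rule sum.swap)
      finally show ?thesis
        by (simp add: mult_ac)
    qed
    have "(\<Sum>s<n. \<Sum>t<n. 2 * G $$ (s, t) *
          (\<Sum>l<m. D l s * A x0 $$ (l, t) + D l t * A x0 $$ (l, s))) =
        2 * ((\<Sum>s<n. \<Sum>t<n. \<Sum>l<m. G $$ (s, t) * (D l s * A x0 $$ (l, t))) +
             (\<Sum>s<n. \<Sum>t<n. \<Sum>l<m. G $$ (s, t) * (D l t * A x0 $$ (l, s))))"
      by (simp add: sum.distrib sum_distrib_left distrib_left mult.assoc)
    then show ?thesis
      unfolding a b by (simp add: sum.distrib sum_distrib_left distrib_left)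
  qed
  ultimately show ?thesis
    unfolding F by simp
qed

theorem theorem2p1:
  fixes k N n p q :: nat and \<alpha> :: real and K M G :: "real mat" and F :: "real mat \<Rightarrow> real"
  assumes "k \<ge> 1" and "N \<ge> 1" and "n = N\<^sup>2"
    and "K \<in> carrier_mat k k"
    and "p < k" and "q < k"
    and "M = transf_mat N K"
    and "G = transpose_mat M * M - \<alpha> \<cdot>\<^sub>m 1\<^sub>m n"
    and "F = (\<lambda>L. (frobenius_norm
      (transpose_mat (transf_mat N L) * transf_mat N L - \<alpha> \<cdot>\<^sub>m 1\<^sub>m n))\<^sup>2)"
  shows "partially_differentiable F K p q \<and>
    1 / 2 * partial_deriv F K p q =
      (\<Sum>(i, j) \<in> occupied k N p q.
         (\<Sum>t<n. G $$ (j, t) * M $$ (i, t)) + (\<Sum>s<n. G $$ (s, j) * M $$ (i, s)))"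
proof -
  define A where "A x = transf_mat N (K |\<^sub>m (p, q) \<mapsto> x)" for x
  define \<Omega> where "\<Omega> = occupied k N p q"
  define S where "S = (\<lambda>(i, j). (\<Sum>t<n. G $$ (j, t) * M $$ (i, t)) + (\<Sum>s<n. G $$ (s, j) * M $$ (i, s)))"
  have A_car: "A x \<in> carrier_mat n n" for x
    using assms by (simp add: A_def transf_mat_eq_kernel_toeplitz[of _ k])
  \<comment> \<open>Writing back the present value changes nothing, so the curve \<open>A\<close>
    passes through \<open>M\<close> at \<open>K $$ (p, q)\<close>.\<close>
  have "K |\<^sub>m (p, q) \<mapsto> K $$ (p, q) = K"
    by (intro eq_matI) (auto simp: index_update_mat_if)
  then have A0: "A (K $$ (p, q)) = M"
    using assms by (simp add: A_def)
  \<comment> \<open>As a function of \<open>x\<close>, each entry is the identity on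
    \<open>\<Omega>\<close> and constant off it.\<close>
  have A': "((\<lambda>x. A x $$ (i, j)) has_field_derivative (if (i, j) \<in> \<Omega> then 1 else 0)) (at (K $$ (p, q)))"
    if "i < n" "j < n" for i j
    using that assms by (auto simp: A_def transf_mat_update \<Omega>_def)
  have \<Omega>: "\<Omega> \<subseteq> {..<n} \<times> {..<n}"
    using assms by (auto simp: \<Omega>_def occupied_def)
  \<comment> \<open>With \<open>D\<close> the indicator of \<open>\<Omega>\<close>, the sum over all
    positions collapses to a sum over \<open>\<Omega>\<close>.\<close>
  have "2 * (\<Sum>i<n. \<Sum>j<n. (if (i, j) \<in> \<Omega> then 1 else 0) * S (i, j)) =
      2 * (\<Sum>x\<in>{..<n} \<times> {..<n}. if x \<in> \<Omega> then S x else 0)"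
    by (auto simp: sum.cartesian_product intro!: sum.cong)
  also have "\<dots> = 2 * sum S \<Omega>"
    using \<Omega> by (simp add: sum.If_cases Int_absorb1)
  finally have "(entry_slice F K p q has_field_derivative 2 * sum S \<Omega>) (at (K $$ (p, q)))"
    using frobenius_gram_has_derivative[OF A_car A', of G \<alpha>] assms(8,9) A0
    by (simp add: entry_slice_def A_def S_def)
  \<comment> \<open>The one derivative fact gives both differentiability and the value; the factor 2
    from the squares cancels the \<open>1 / 2\<close>.\<close>
  then show ?thesis
    by (auto simp: partially_differentiable_def partial_deriv_def field_differentiable_def
        DERIV_imp_deriv S_def \<Omega>_def)
qed

end
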